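(* Let $\mathcal{G}=(G_n)_{n\ge1}$ be an $\mathrm{Inc}$-invariant chain of graphs with stability index $r=\mathrm{ind}(\mathcal{G})$. Assume that $V(G_r)=[r]$ and that $(1,i),(j,r)\in E(G_r)$ for some $i,j\in[r]$. Denote by $\mathrm{IN}(G_n)$ and $\alpha(G_n)$ the independence complex and the independence number of $G_n$, respectively, and let $\nu(\mathrm{IN}(G_n))$ denote the number of facets of $\mathrm{IN}(G_n)$. Then: (i) $\alpha(G_n)$ is eventually constant (i.e. constant for all sufficiently large $n$). (ii) For each $i\ge0$, $f_i(\mathrm{IN}(G_n))$ is eventually a linear function of $n$. (iii) For each $i\ge0$, $h_i(\mathrm{IN}(G_n))$ is eventually a linear function of $n$. (iv) There exists a constant $C\in\mathbb{Z}$ such that $\nu(\mathrm{IN}(G_n))=n+C$ for all sufficiently large $n$.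
   Context: $\mathbb{N}$ is the set of positive integers and $[n]=\{1,\dots,n\}$. Graphs are simple and finite, with vertex set contained in $\mathbb{N}$ (possibly empty); an edge $\{i,j\}$ with $i<j$ is written $(i,j)$. $G\subseteq H$ means $V(G)\subseteq V(H)$ and $E(G)\subseteq E(H)$. $\mathrm{Inc}$ is the monoid of strictly increasing maps $\pi:\mathbb{N}\to\mathbb{N}$, and $\mathrm{Inc}_{n,m}=\{\pi\in\mathrm{Inc}\mid\pi(n)\le m\}$ for $n\le m$. For $\Gamma\subseteq\mathrm{Inc}$ and a graph $G$, $\Gamma(G)$ is the graph with vertex set $\bigcup_{\pi\in\Gamma}\pi(V(G))$ and edge set $\{(\pi(i),\pi(j))\mid \pi\in\Gamma,(i,j)\in E(G)\}$. An $\mathrm{Inc}$-invariant chain of graphs is a sequence $(G_n)_{n\ge1}$ of graphs with $V(G_n)\subseteq[n]$ and $\mathrm{Inc}_{n,m}(G_n)\subseteq G_m$ for all $m\ge n\ge1$. Every such chain stabilizes: there is $r\in\mathbb{N}$ with $\mathrm{Inc}_{n,m}(G_n)=G_m$ for all $m\ge n\ge r$; the smallest such $r$ is the stability index $\mathrm{ind}(\mathcal{G})$. The independence complex $\mathrm{IN}(G)$ is the simplicial complex on $V(G)$ whose faces are the independent sets of $G$; $\alpha(G)$ is the maximum size of an independent set. For a simplicial complex $\Delta$ of dimension $d-1$, $f_i(\Delta)$ is the number of faces with $i+1$ elements ($f_{-1}=1$, and $f_i=0$ for $i\ge d$), and the $h$-vector is given by $h_j(\Delta)=\sum_{i=0}^j(-1)^{j-i}\binom{d-i}{j-i}f_{i-1}(\Delta)$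 for $0\le j\le d$, with $h_j=0$ for $j>d$. Facets are the inclusion-maximal faces. A linear function of $n$ means $an+b$ (with $a=0$ allowed). *)

theory Defs
  imports Complex_Main
begin

text \<open>
  The positive integers of the source are the elements of \<open>{1..}\<close> of type \<open>nat\<close>; an edge
  \<open>(i,j)\<close> with \<open>i < j\<close> is the two-element set \<open>{i, j}\<close>.
\<close>

record ngraph =
  verts :: "nat set"
  edges :: "nat set set"

definition simple_graph :: "ngraph \<Rightarrow> bool" where
  "simple_graph G \<longleftrightarrow> finite (verts G) \<and> verts G \<subseteq> {1..} \<and>
     (\<forall>e \<in> edges G. e \<subseteq> verts G \<and> card e = 2)"

definition is_subgraph :: "ngraph \<Rightarrow> ngraph \<Rightarrow> bool" where
  "is_subgraph G H \<longleftrightarrow> verts G \<subseteq> verts H \<and> edges G \<subseteq> edges H"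

text \<open>The value at \<open>0\<close> of a function in \<open>Inc\<close> is irrelevant, since \<open>0\<close> is never a vertex.\<close>

definition Inc :: "(nat \<Rightarrow> nat) set" where
  "Inc = {p. p ` {1..} \<subseteq> {1..} \<and> strict_mono_on {1..} p}"

definition Inc_bounded :: "nat \<Rightarrow> nat \<Rightarrow> (nat \<Rightarrow> nat) set" where
  "Inc_bounded n m = {p \<in> Inc. p n \<le> m}"

definition act :: "(nat \<Rightarrow> nat) set \<Rightarrow> ngraph \<Rightarrow> ngraph" where
  "act \<Gamma> G = \<lparr>verts = (\<Union>p\<in>\<Gamma>. p ` verts G), edges = {p ` e | p e. p \<in> \<Gamma> \<and> e \<in> edges G}\<rparr>"

text \<open>A chain is indexed by \<open>n \<ge> 1\<close>; nothing is required of the value at index \<open>0\<close>.\<close>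

definition Inc_invariant_chain :: "(nat \<Rightarrow> ngraph) \<Rightarrow> bool" where
  "Inc_invariant_chain G \<longleftrightarrow>
     (\<forall>n\<ge>1. simple_graph (G n) \<and> verts (G n) \<subseteq> {1..n}) \<and>
     (\<forall>n\<ge>1. \<forall>m\<ge>n. is_subgraph (act (Inc_bounded n m) (G n)) (G m))"

definition stability_index :: "(nat \<Rightarrow> ngraph) \<Rightarrow> nat" where
  "stability_index G =
     (LEAST r. r \<ge> 1 \<and> (\<forall>n\<ge>r. \<forall>m\<ge>n. act (Inc_bounded n m) (G n) = G m))"

definition independent_set :: "ngraph \<Rightarrow> nat set \<Rightarrow> bool" where
  "independent_set G S \<longleftrightarrow> S \<subseteq> verts G \<and> (\<forall>u\<in>S. \<forall>v\<in>S. {u, v} \<notin> edges G)"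

definition independence_complex :: "ngraph \<Rightarrow> nat set set" where
  "independence_complex G = {S. independent_set G S}"

definition independence_number :: "ngraph \<Rightarrow> nat" where
  "independence_number G = Max {card S | S. independent_set G S}"

text \<open>
  A simplicial complex is given by its set of faces, including the empty face, so the complex
  whose only face is empty has dimension \<open>-1\<close>.
\<close>

definition complex_dim :: "'a set set \<Rightarrow> int" where
  "complex_dim \<Delta> = int (Max (card ` \<Delta>)) - 1"

definition f_num :: "'a set set \<Rightarrow> int \<Rightarrow> nat" where
  "f_num \<Delta> i = card {F \<in> \<Delta>. int (card F) = i + 1}"

definition h_num :: "'a set set \<Rightarrow> nat \<Rightarrow> int" where
  "h_num \<Delta> j =
     (let d = nat (complex_dim \<Delta> + 1) in
      if j \<le> d
      then \<Sum>i=0..j. (-1) ^ (j - i) * int ((d - i) choose (j - i)) * int (f_num \<Delta> (int i - 1))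
      else 0)"

definition facets :: "'a set set \<Rightarrow> 'a set set" where
  "facets \<Delta> = {F \<in> \<Delta>. \<forall>F' \<in> \<Delta>. F \<subseteq> F' \<longrightarrow> F' = F}"

text \<open>
  For an integer-valued function, real coefficients would give the same notion: both are
  determined by two consecutive values.
\<close>

definition eventually_linear :: "(nat \<Rightarrow> int) \<Rightarrow> bool" where
  "eventually_linear g \<longleftrightarrow> (\<exists>a b :: int. eventually (\<lambda>n. g n = a * int n + b) sequentially)"

end

theory Submission
  imports Defs
begin

text \<open>
  Describe a pair \<open>x < y\<close> of vertices in \<open>{1..n}\<close> by the triple \<open>(x, y - x, n - y)\<close> of its distances
  to the left end, to each other and to the right end. An increasing map can carry one pair to
  another exactly when none of the three numbers decreases, so the edges of all graphs of the chain
  together form an upward closed set of triples. By Dickson's lemma finitely many triples generate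
  it (\<open>dickson_triples\<close>); hence the chain stabilizes (\<open>chain_stabilizes\<close>), and from the stability
  index \<open>r\<close> on, adjacency depends only on the triple with its entries cut off at \<open>r\<close>
  (\<open>pair_type_truncate\<close>).

  The edge \<open>(1,i)\<close> makes every pair at distance at least \<open>r\<close> whose right vertex is at least \<open>r\<close>
  away from the right end an edge, and the edge \<open>(j,r)\<close> does the same at the left end. So two
  non-adjacent vertices are close, or they sit near opposite ends. Away from the ends the graph is
  that of a power of a path: two vertices are adjacent exactly when their distance is at least a
  fixed number \<open>w \<ge> 1\<close>, the \<open>width\<close>.

  Consequently the independent sets are of two kinds. Those that meet one of the two ends stay near
  the ends, and lengthening the middle gives a bijection from those of \<open>G n\<close> to those of
  \<open>G (Suc n)\<close> that preserves cardinality and inclusion (\<open>end_faces_Suc\<close>). The others are the subsets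
  of a middle interval with diameter less than \<open>w\<close>, and one step of the chain adds the sets whose
  maximum is the new right end of that interval (\<open>mid_faces_Suc\<close>): \<open>w - 1 choose k\<close> of them have
  \<open>k + 1\<close> elements. The facets of the second kind are the windows of \<open>w\<close> consecutive middle
  vertices, and one step adds exactly one (\<open>mid_facets\<close>). Thus face numbers and the number of facets
  have eventually constant increments, the latter equal to \<open>1\<close>. The set of cardinalities of faces
  does not change any more, so the dimension is eventually constant, and then each \<open>h\<close>-number is a
  fixed integer combination of face numbers.
\<close>

section \<open>Pairs under increasing maps\<close>

text \<open>
  The map that inserts a gap of length \<open>d\<close> just before \<open>x\<close> and one of length \<open>e\<close> just before \<open>y\<close>. Such
  maps realize every increase of the distances that describe a pair.
\<close>

definition spread :: "nat \<Rightarrow> nat \<Rightarrow> nat \<Rightarrow> nat \<Rightarrow> nat \<Rightarrow> nat" where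
  "spread x y d e k = k + (if x \<le> k then d else 0) + (if y \<le> k then e else 0)"

lemma spread_in_Inc: "spread x y d e \<in> Inc"
  by (auto simp: Inc_def spread_def strict_mono_on_def)

lemma Inc_moves_vertex:
  assumes "a \<le> a'" "c \<le> c'"
  shows "\<exists>p \<in> Inc_bounded (a + c) (a' + c'). p a = a'"
  using assms
  by (intro bexI[of _ "spread a a (a' - a) 0"])
     (auto simp: Inc_bounded_def spread_in_Inc, auto simp: spread_def)

lemma Inc_moves_pair:
  assumes "1 \<le> b" "a \<le> a'" "b \<le> b'" "c \<le> c'"
  shows "\<exists>p \<in> Inc_bounded (a + b + c) (a' + b' + c'). p a = a' \<and> p (a + b) = a' + b'"
  using assms
  by (intro bexI[of _ "spread a (a + b) (a' - a) (b' - b)"])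
     (auto simp: Inc_bounded_def spread_in_Inc, auto simp: spread_def)

lemma Inc_stretches:
  assumes "p \<in> Inc" "1 \<le> x" "x \<le> y"
  shows "p x + (y - x) \<le> p y"
  using assms(3)
proof (induction rule: dec_induct)
  case (step k)
  have "p k < p (Suc k)"
    using assms step by (auto simp: Inc_def strict_mono_on_def)
  then show ?case using step by auto
qed simp

lemma Inc_increases:
  assumes "p \<in> Inc" "1 \<le> x"
  shows "x \<le> p x"
proof -
  have "1 \<le> p 1" using assms by (auto simp: Inc_def)
  then show ?thesis using Inc_stretches[OF assms(1), of 1 x] assms(2) by auto
qed

text \<open>
  In these coordinates the action of \<open>Inc\<close> on pairs is the componentwise order on triples.
\<close>

definition pair_type :: "(nat \<Rightarrow> ngraph) \<Rightarrow> nat \<Rightarrow> nat \<Rightarrow> nat \<Rightarrow> bool" where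
  "pair_type G a b c \<longleftrightarrow> {a, a + b} \<in> edges (G (a + b + c))"

lemma chain_simple:
  assumes "Inc_invariant_chain G" "1 \<le> n"
  shows "simple_graph (G n)" "verts (G n) \<subseteq> {1..n}"
  using assms by (auto simp: Inc_invariant_chain_def)

lemma chain_act:
  assumes "Inc_invariant_chain G" "1 \<le> n" "n \<le> m"
  shows "verts (act (Inc_bounded n m) (G n)) \<subseteq> verts (G m)"
    "edges (act (Inc_bounded n m) (G n)) \<subseteq> edges (G m)"
  using assms by (auto simp: Inc_invariant_chain_def is_subgraph_def)

lemma not_pair_type_0:
  assumes "Inc_invariant_chain G" "1 \<le> a"
  shows "\<not> pair_type G a 0 c"
  using chain_simple[OF assms(1), of "a + c"] assms(2)
  by (auto simp: pair_type_def simple_graph_def)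

lemma edge_cases:
  assumes "Inc_invariant_chain G" "1 \<le> n" "e \<in> edges (G n)"
  obtains a b c where "1 \<le> a" "1 \<le> b" "n = a + b + c" "e = {a, a + b}" "pair_type G a b c"
proof -
  have e: "e \<subseteq> {1..n}" "card e = 2"
    using chain_simple[OF assms(1,2)] assms(3) by (auto simp: simple_graph_def)
  then obtain x y where "e = {x, y}" "x < y"
    by (metis card_2_iff insert_commute linorder_neqE_nat)
  then show thesis
    using e assms(3) that[of x "y - x" "n - y"] by (auto simp: pair_type_def)
qed

text \<open>
  Edges form an upward closed set of triples: the map from \<open>Inc_moves_pair\<close> carries the smaller
  pair to the larger one, and the chain is invariant.
\<close>

lemma pair_type_mono:
  assumes "Inc_invariant_chain G" "pair_type G a b c" "1 \<le> a" "a \<le> a'" "b \<le> b'" "c \<le> c'"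
  shows "pair_type G a' b' c'"
proof -
  have "1 \<le> b" using not_pair_type_0[of G a c] assms by (cases b) auto
  then obtain p where p: "p \<in> Inc_bounded (a + b + c) (a' + b' + c')" "p a = a'" "p (a + b) = a' + b'"
    using Inc_moves_pair assms(4-6) by blast
  have "p ` {a, a + b} \<in> edges (act (Inc_bounded (a + b + c) (a' + b' + c')) (G (a + b + c)))"
    using p(1) assms(2) unfolding act_def pair_type_def ngraph.simps by blast
  then show ?thesis
    using chain_act(2)[OF assms(1), of "a + b + c" "a' + b' + c'"] assms p(2,3)
    by (auto simp: pair_type_def)
qed

section \<open>Stabilization\<close>

lemma nondecreasing_subsequence:
  fixes f :: "nat \<Rightarrow> nat"
  shows "\<exists>g :: nat \<Rightarrow> nat. strict_mono g \<and> mono (\<lambda>k. f (g k))"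
proof -
  obtain g where g: "strict_mono g" "monoseq (\<lambda>k. f (g k))"
    using seq_monosub[of f] by auto
  show ?thesis
  proof (cases "mono (\<lambda>k. f (g k))")
    case False
    then have dec: "f (g k) \<le> f (g l)" if "l \<le> k" for k l
      using g(2) that by (auto simp: monoseq_iff monotone_def)
    \<comment> \<open>A nonincreasing sequence of naturals is constant from the place of its minimum on.\<close>
    obtain l where l: "\<And>k. f (g l) \<le> f (g k)"
      using ex_has_least_nat[of "\<lambda>_. True" 0 "\<lambda>k. f (g k)"] by auto
    then have "f (g (l + k)) = f (g l)" for k
      using dec[of l "l + k"] by (simp add: le_antisym)
    moreover have "strict_mono (\<lambda>k. g (l + k))"
      using g(1) by (auto simp: strict_mono_def)
    ultimately show ?thesis
      by (intro exI[of _ "\<lambda>k. g (l + k)"]) (auto simp: monotone_def)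
  qed (use g in auto)
qed

text \<open>
  Dickson's lemma in the form of a degree bound. If no bound worked, there would be, for each \<open>N\<close>, a
  triple with \<open>P\<close> that lies above no \<open>P\<close>-triple of sum at most \<open>N\<close>. Along a common subsequence \<open>s\<close>
  on which all three coordinates are nondecreasing, the triple at \<open>s 0\<close> lies below every later one;
  as soon as \<open>s k\<close> exceeds the sum of that first triple, this is a contradiction.
\<close>

lemma dickson_triples:
  fixes P :: "nat \<Rightarrow> nat \<Rightarrow> nat \<Rightarrow> bool"
  obtains N where "\<And>a b c. P a b c \<Longrightarrow>
    \<exists>a' b' c'. a' \<le> a \<and> b' \<le> b \<and> c' \<le> c \<and> P a' b' c' \<and> a' + b' + c' \<le> N"
proof (rule ccontr)
  assume neg: "\<not> thesis"
  have "\<forall>N. \<exists>a b c. P a b c \<and>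
      (\<forall>a' b' c'. a' \<le> a \<and> b' \<le> b \<and> c' \<le> c \<and> P a' b' c' \<longrightarrow> N < a' + b' + c')"
    using neg that by (metis not_less)
  then obtain A B C where ABC: "\<And>N. P (A N) (B N) (C N)"
    "\<And>N a' b' c'. a' \<le> A N \<Longrightarrow> b' \<le> B N \<Longrightarrow> c' \<le> C N \<Longrightarrow> P a' b' c' \<Longrightarrow> N < a' + b' + c'"
    by metis
  obtain f :: "nat \<Rightarrow> nat" where f: "strict_mono f" "mono (\<lambda>k. A (f k))"
    using nondecreasing_subsequence by blast
  obtain g :: "nat \<Rightarrow> nat" where g: "strict_mono g" "mono (\<lambda>k. B (f (g k)))"
    using nondecreasing_subsequence[of "\<lambda>k. B (f k)"] by blast
  obtain h :: "nat \<Rightarrow> nat" where h: "strict_mono h" "mono (\<lambda>k. C (f (g (h k))))"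
    using nondecreasing_subsequence[of "\<lambda>k. C (f (g k))"] by blast
  define s where "s k = f (g (h k))" for k
  have s: "strict_mono s"
    unfolding s_def using f(1) g(1) h(1) by (auto simp: strict_mono_def)
  have "g (h 0) \<le> g (h k)" "h 0 \<le> h k" for k
    using g(1) h(1) by (auto simp: strict_mono_less_eq)
  then have "A (s 0) \<le> A (s k)" "B (s 0) \<le> B (s k)" "C (s 0) \<le> C (s k)" for k
    unfolding s_def using f(2) g(2) h(2) by (auto dest: monoD)
  then have "s k < A (s 0) + B (s 0) + C (s 0)" for k
    using ABC(2)[of "A (s 0)" "s k" "B (s 0)" "C (s 0)"] ABC(1)[of "s 0"] by auto
  moreover have "k \<le> s k" for k using s by (rule seq_suble)
  ultimately show False by (meson not_less)
qed

lemma interpolate_triple: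
  fixes a b c :: nat
  assumes "a' \<le> a" "b' \<le> b" "c' \<le> c" "a' + b' + c' \<le> n" "n \<le> a + b + c"
  obtains x y z where "a' \<le> x" "x \<le> a" "b' \<le> y" "y \<le> b" "c' \<le> z" "z \<le> c" "x + y + z = n"
proof -
  define x where "x = min a (n - b' - c')"
  define y where "y = min b (n - x - c')"
  have "a' \<le> x" "x \<le> a" "b' \<le> y" "y \<le> b" "c' \<le> n - x - y" "n - x - y \<le> c" "x + y + (n - x - y) = n"
    using assms by (auto simp: x_def y_def min_def)
  then show thesis by (rule that)
qed

text \<open>
  An edge of \<open>G m\<close> lies above a generating triple of bounded sum; an intermediate triple of sum \<open>n\<close>
  is an edge of \<open>G n\<close> and is moved to the given one. Vertices are handled in the same way with the
  pair of distances to the two ends, the middle coordinate being a dummy.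
\<close>

lemma chain_stabilizes:
  assumes "Inc_invariant_chain G"
  shows "\<exists>r\<ge>1. \<forall>n\<ge>r. \<forall>m\<ge>n. act (Inc_bounded n m) (G n) = G m"
proof -
  obtain N where N: "\<And>a b c. 1 \<le> a \<and> 1 \<le> b \<and> pair_type G a b c \<Longrightarrow> \<exists>a' b' c'. a' \<le> a \<and> b' \<le> b \<and>
      c' \<le> c \<and> (1 \<le> a' \<and> 1 \<le> b' \<and> pair_type G a' b' c') \<and> a' + b' + c' \<le> N"
    using dickson_triples[of "\<lambda>a b c. 1 \<le> a \<and> 1 \<le> b \<and> pair_type G a b c"] by metis
  obtain M where M: "\<And>a b c. 1 \<le> a \<and> a \<in> verts (G (a + c)) \<Longrightarrow> \<exists>a' b' c'. a' \<le> a \<and> b' \<le> b \<and>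
      c' \<le> c \<and> (1 \<le> a' \<and> a' \<in> verts (G (a' + c'))) \<and> a' + b' + c' \<le> M"
    using dickson_triples[of "\<lambda>a b c. 1 \<le> a \<and> a \<in> verts (G (a + c))"] by metis
  have "act (Inc_bounded n m) (G n) = G m" if nm: "Suc (N + M) \<le> n" "n \<le> m" for n m
  proof -
    have "edges (G m) \<subseteq> edges (act (Inc_bounded n m) (G n))"
    proof
      fix e assume "e \<in> edges (G m)"
      then obtain a b c where abc: "1 \<le> a" "1 \<le> b" "m = a + b + c" "e = {a, a + b}" "pair_type G a b c"
        using edge_cases[OF assms, of m e] nm by auto
      then obtain a' b' c' where g: "a' \<le> a" "b' \<le> b" "c' \<le> c" "1 \<le> a'" "1 \<le> b'"
        "pair_type G a' b' c'" "a' + b' + c' \<le> N"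
        using N by blast
      obtain x y z where xyz: "a' \<le> x" "x \<le> a" "b' \<le> y" "y \<le> b" "c' \<le> z" "z \<le> c" "x + y + z = n"
        using interpolate_triple[of a' a b' b c' c n] g abc nm by auto
      have "pair_type G x y z"
        using pair_type_mono[OF assms g(6,4)] xyz by auto
      moreover obtain p where "p \<in> Inc_bounded n m" "p x = a" "p (x + y) = a + b"
        using Inc_moves_pair[of y x a b z c] xyz g abc by auto
      ultimately show "e \<in> edges (act (Inc_bounded n m) (G n))"
        unfolding act_def pair_type_def using abc(4) xyz(7)
        by (auto intro!: exI[of _ p] exI[of _ "{x, x + y}"])
    qed
    moreover have "verts (G m) \<subseteq> verts (act (Inc_bounded n m) (G n))"
    proof
      fix a assume a: "a \<in> verts (G m)"
      then have am: "1 \<le> a" "a \<le> m"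
        using chain_simple(2)[OF assms, of m] nm by auto
      obtain a' c' where g: "a' \<le> a" "c' \<le> m - a" "1 \<le> a'" "a' \<in> verts (G (a' + c'))" "a' + c' \<le> M"
        using M[of a "m - a" 0] a am by auto
      obtain x y z where xyz: "a' \<le> x" "x \<le> a" "y \<le> 0" "c' \<le> z" "z \<le> m - a" "x + y + z = n"
        using interpolate_triple[of a' a 0 0 c' "m - a" n] g am nm by auto
      \<comment> \<open>The intermediate vertex \<open>x\<close> of \<open>G n\<close> comes from the generating vertex.\<close>
      obtain q where q: "q \<in> Inc_bounded (a' + c') n" "q a' = x"
        using Inc_moves_vertex[of a' x c' z] xyz by auto
      have "x \<in> verts (act (Inc_bounded (a' + c') n) (G (a' + c')))"
        unfolding act_def using q g(4) by auto
      then have "x \<in> verts (G n)"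
        using chain_act(1)[OF assms, of "a' + c'" n] xyz g by auto
      moreover obtain p where "p \<in> Inc_bounded n m" "p x = a"
        using Inc_moves_vertex[of x a z "m - a"] xyz am by auto
      ultimately show "a \<in> verts (act (Inc_bounded n m) (G n))"
        unfolding act_def by auto
    qed
    ultimately show ?thesis
      using chain_act[OF assms, of n m] nm by (intro ngraph.equality) auto
  qed
  then show ?thesis by (intro exI[of _ "Suc (N + M)"]) auto
qed

section \<open>Eventually linear functions\<close>

lemma constant_increment:
  fixes g :: "nat \<Rightarrow> int"
  assumes "\<And>n. N \<le> n \<Longrightarrow> g (Suc n) = g n + a" "N \<le> n"
  shows "g n = a * int n + (g N - a * int N)"
  using assms(2) by (induction rule: dec_induct) (auto simp: assms(1) algebra_simps)

lemma eventually_linear_if_constant_increment: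
  fixes g :: "nat \<Rightarrow> int"
  assumes "\<And>n. N \<le> n \<Longrightarrow> g (Suc n) = g n + a"
  shows "eventually_linear g"
  unfolding eventually_linear_def eventually_sequentially
  using constant_increment[of N g a, OF assms] by blast

lemma eventually_linear_const: "eventually_linear (\<lambda>_. c)"
  by (rule eventually_linear_if_constant_increment[where a = 0]) auto

lemma eventually_linear_add:
  assumes "eventually_linear f" "eventually_linear g"
  shows "eventually_linear (\<lambda>n. f n + g n)"
proof -
  obtain a b c d where "\<forall>\<^sub>F n in sequentially. f n = a * int n + b"
    "\<forall>\<^sub>F n in sequentially. g n = c * int n + d"
    using assms by (auto simp: eventually_linear_def)
  then have "\<forall>\<^sub>F n in sequentially. f n + g n = (a + c) * int n + (b + d)"
    by eventually_elim (simp add: algebra_simps)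
  then show ?thesis unfolding eventually_linear_def by blast
qed

lemma eventually_linear_cmult:
  assumes "eventually_linear f"
  shows "eventually_linear (\<lambda>n. c * f n)"
proof -
  obtain a b where "\<forall>\<^sub>F n in sequentially. f n = a * int n + b"
    using assms by (auto simp: eventually_linear_def)
  then have "\<forall>\<^sub>F n in sequentially. c * f n = (c * a) * int n + c * b"
    by eventually_elim (simp add: algebra_simps)
  then show ?thesis unfolding eventually_linear_def by blast
qed

lemma eventually_linear_sum:
  assumes "finite I" "\<And>k. k \<in> I \<Longrightarrow> eventually_linear (f k)"
  shows "eventually_linear (\<lambda>n. \<Sum>k\<in>I. f k n)"
  using assms
  by (induction I rule: finite_induct) (auto intro: eventually_linear_add eventually_linear_const)

lemma eventually_linear_cong:
  assumes "eventually_linear f" "\<And>n. N \<le> n \<Longrightarrow> f n = g n"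
  shows "eventually_linear g"
proof -
  obtain a b where "\<forall>\<^sub>F n in sequentially. f n = a * int n + b"
    using assms by (auto simp: eventually_linear_def)
  moreover have "\<forall>\<^sub>F n in sequentially. N \<le> n" by (rule eventually_ge_at_top)
  ultimately have "\<forall>\<^sub>F n in sequentially. g n = a * int n + b"
    by eventually_elim (simp add: assms(2))
  then show ?thesis unfolding eventually_linear_def by blast
qed

section \<open>Adjacency far along the chain\<close>

text \<open>
  The situation of the theorem, with \<open>r\<close> any index from which the chain is generated by \<open>G r\<close>.
\<close>

locale linked_chain =
  fixes G :: "nat \<Rightarrow> ngraph" and r i j :: nat
  assumes chain: "Inc_invariant_chain G"
    and r_pos: "1 \<le> r"
    and stable: "r \<le> n \<Longrightarrow> act (Inc_bounded r n) (G r) = G n"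
    and full: "verts (G r) = {1..r}"
    and first_edge: "{1, i} \<in> edges (G r)"
    and last_edge: "{j, r} \<in> edges (G r)"
begin

abbreviation IN :: "nat \<Rightarrow> nat set set" where
  "IN n \<equiv> independence_complex (G n)"

lemma verts_eq:
  assumes "r \<le> n"
  shows "verts (G n) = {1..n}"
proof
  show "verts (G n) \<subseteq> {1..n}" using chain_simple[OF chain, of n] r_pos assms by auto
  show "{1..n} \<subseteq> verts (G n)"
  proof
    fix x assume x: "x \<in> {1..n}"
    have "min x r \<le> x" "r - min x r \<le> n - x" "min x r + (r - min x r) = r" "x + (n - x) = n"
      using x assms by auto
    then obtain p where "p \<in> Inc_bounded r n" "p (min x r) = x"
      using Inc_moves_vertex[of "min x r" x "r - min x r" "n - x"] by auto
    moreover have "min x r \<in> verts (G r)" using full x r_pos by auto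
    ultimately have "x \<in> verts (act (Inc_bounded r n) (G r))"
      unfolding act_def ngraph.simps by (metis UN_iff imageI)
    then show "x \<in> verts (G n)" using stable[OF assms] by simp
  qed
qed

lemma pair_type_generated:
  assumes "pair_type G a b c" "1 \<le> a" "r \<le> a + b + c"
  obtains a' b' c' where "1 \<le> a'" "a' \<le> a" "b' \<le> b" "c' \<le> c" "a' + b' + c' = r" "pair_type G a' b' c'"
proof -
  have "1 \<le> b" using not_pair_type_0[OF chain assms(2)] assms(1) by (cases b) auto
  have "{a, a + b} \<in> edges (act (Inc_bounded r (a + b + c)) (G r))"
    using assms stable by (simp add: pair_type_def)
  then obtain p e where p: "p \<in> Inc" "p r \<le> a + b + c" "e \<in> edges (G r)" "{a, a + b} = p ` e"
    by (auto simp: act_def Inc_bounded_def)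
  obtain x y z where xyz: "1 \<le> x" "1 \<le> y" "r = x + y + z" "e = {x, x + y}" "pair_type G x y z"
    using edge_cases[OF chain r_pos p(3)] by blast
  have "p x + y \<le> p (x + y)" "p (x + y) + z \<le> p r" "x \<le> p x"
    using Inc_stretches[OF p(1), of x "x + y"] Inc_stretches[OF p(1), of "x + y" r]
      Inc_increases[OF p(1), of x] xyz by auto
  moreover from this have "p x = a" "p (x + y) = a + b"
    using p(4) xyz \<open>1 \<le> b\<close> by (auto simp: doubleton_eq_iff)
  ultimately show thesis
    using that[of x y z] xyz p(2) by auto
qed

text \<open>
  A triple is an edge because of a generator of sum \<open>r\<close> below it. The entries of the generator are
  at most \<open>r\<close>, so it also lies below the triple cut off at \<open>r\<close>.
\<close>

lemma pair_type_truncate: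
  assumes "pair_type G a b c" "1 \<le> a" "r \<le> a + b + c"
    and "min a r \<le> a'" "min b r \<le> b'" "min c r \<le> c'"
  shows "pair_type G a' b' c'"
proof -
  obtain x y z where "1 \<le> x" "x \<le> a" "y \<le> b" "z \<le> c" "x + y + z = r" "pair_type G x y z"
    using pair_type_generated[OF assms(1-3)] by metis
  then show ?thesis
    using pair_type_mono[OF chain] assms(4-6) by auto
qed

text \<open>
  The edge \<open>{1, i}\<close> is a triple with first entry \<open>1\<close>, the least possible, so the first coordinate
  imposes no condition. In the next lemma the edge \<open>{j, r}\<close> has third entry \<open>0\<close>, with the same
  effect on the third coordinate.
\<close>

lemma long_pair_left:
  assumes "1 \<le> a" "r \<le> b" "r \<le> c"
  shows "pair_type G a b c"
proof -
  obtain x y z where xyz: "1 \<le> x" "1 \<le> y" "r = x + y + z" "{1, i} = {x, x + y}" "pair_type G x y z"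
    using edge_cases[OF chain r_pos first_edge] by blast
  have "1 \<in> {x, x + y}" unfolding xyz(4)[symmetric] by simp
  then have "x = 1" using xyz(1,2) by auto
  then show ?thesis using pair_type_mono[OF chain xyz(5,1)] xyz(3) assms by auto
qed

lemma long_pair_right:
  assumes "r \<le> a" "r \<le> b"
  shows "pair_type G a b c"
proof -
  obtain x y z where xyz: "1 \<le> x" "1 \<le> y" "r = x + y + z" "{j, r} = {x, x + y}" "pair_type G x y z"
    using edge_cases[OF chain r_pos last_edge] by blast
  have "r \<in> {x, x + y}" unfolding xyz(4)[symmetric] by simp
  then have "z = 0" using xyz(2,3) by auto
  then show ?thesis using pair_type_mono[OF chain xyz(5,1)] xyz(3) assms by auto
qed

text \<open>
  The least distance at which two vertices far from both ends are adjacent.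
\<close>

definition width :: nat where
  "width = (LEAST b. pair_type G r b r)"

lemma width_le_iff: "pair_type G r b r \<longleftrightarrow> width \<le> b"
proof
  show "width \<le> b" if "pair_type G r b r" using that unfolding width_def by (rule Least_le)
  have "pair_type G r width r"
    unfolding width_def using long_pair_right[of r r r] by (intro LeastI) auto
  then show "pair_type G r b r" if "width \<le> b"
    using pair_type_mono[OF chain _ r_pos] that by auto
qed

lemma width_bounds: "1 \<le> width" "width \<le> r"
  using width_le_iff[of 0] width_le_iff[of r] not_pair_type_0[OF chain r_pos]
    long_pair_right[of r r r] by (auto simp: not_le)

lemma pair_type_inner:
  assumes "r \<le> a" "r \<le> c"
  shows "pair_type G a b c \<longleftrightarrow> width \<le> b"
proof -
  have "pair_type G a b c \<longleftrightarrow> pair_type G r b r"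
    using pair_type_truncate[of a b c r b r] pair_type_mono[OF chain _ r_pos, of b r a b c] assms r_pos
    by auto
  then show ?thesis using width_le_iff by simp
qed

text \<open>
  One vertex far from both ends is enough: either the other is close to it, and both are at least
  \<open>r\<close> away from the ends, or the pair is long and one of its sides has enough room.
\<close>

lemma pair_type_middle:
  assumes "1 \<le> x" "x < y" "y \<le> n"
    and "2 * r \<le> x \<and> x + 2 * r \<le> n \<or> 2 * r \<le> y \<and> y + 2 * r \<le> n"
  shows "pair_type G x (y - x) (n - y) \<longleftrightarrow> width \<le> y - x"
proof (cases "y - x < r")
  case True
  then show ?thesis using assms by (intro pair_type_inner) auto
next
  case False
  then have "pair_type G x (y - x) (n - y)"
    using assms long_pair_left[of x "y - x" "n - y"] long_pair_right[of x "y - x" "n - y"] by auto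
  then show ?thesis using False width_bounds by auto
qed

lemma IN_iff:
  assumes "r \<le> n"
  shows "S \<in> IN n \<longleftrightarrow>
    S \<subseteq> {1..n} \<and> (\<forall>x\<in>S. \<forall>y\<in>S. x < y \<longrightarrow> \<not> pair_type G x (y - x) (n - y))"
proof -
  have "(\<forall>u\<in>S. \<forall>v\<in>S. {u, v} \<notin> edges (G n)) \<longleftrightarrow>
      (\<forall>x\<in>S. \<forall>y\<in>S. x < y \<longrightarrow> \<not> pair_type G x (y - x) (n - y))" if S: "S \<subseteq> {1..n}"
  proof -
    have *: "pair_type G x (y - x) (n - y) \<longleftrightarrow> {x, y} \<in> edges (G n)" if "x < y" "y \<in> S" for x y
      using that S by (auto simp: pair_type_def)
    have "{u, u} \<notin> edges (G n)" for u
      using chain_simple(1)[OF chain, of n] r_pos assms by (force simp: simple_graph_def)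
    then show ?thesis using * by (metis insert_commute linorder_neqE_nat)
  qed
  then show ?thesis
    using verts_eq[OF assms] by (auto simp: independence_complex_def independent_set_def)
qed

lemma finite_IN: "r \<le> n \<Longrightarrow> finite (IN n)"
  by (rule finite_subset[of _ "Pow {1..n}"]) (use IN_iff in blast)+

lemma IN_finite: "r \<le> n \<Longrightarrow> S \<in> IN n \<Longrightarrow> finite S"
  using finite_subset[of S "{1..n}"] by (auto simp: IN_iff)

section \<open>Faces near the ends\<close>

text \<open>
  The margin \<open>2 * r\<close> leaves room for two things: neighbours within distance \<open>r\<close> of a middle vertex
  are still at least \<open>r\<close> away from the ends, and a vertex beyond that is adjacent to it.
\<close>

definition end_faces :: "nat \<Rightarrow> nat set set" where
  "end_faces n = {S \<in> IN n. \<exists>x\<in>S. x \<le> 2 * r \<or> n < x + 2 * r}"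

definition mid_faces :: "nat \<Rightarrow> nat set set" where
  "mid_faces n = {S \<in> IN n. \<forall>x\<in>S. 2 * r < x \<and> x + 2 * r \<le> n}"

lemma IN_split: "IN n = end_faces n \<union> mid_faces n" "end_faces n \<inter> mid_faces n = {}"
  by (auto simp: end_faces_def mid_faces_def not_le not_less)

text \<open>
  The vertices that a face meeting an end can contain (\<open>end_faces_rim\<close>). For \<open>10 * r \<le> n\<close> a nonempty
  gap separates its two parts, and \<open>stretch\<close> lengthens that gap by one.
\<close>

definition rim :: "nat \<Rightarrow> nat set" where
  "rim n = {x \<in> {1..n}. x \<le> 3 * r \<or> n < x + 3 * r}"

definition stretch :: "nat \<Rightarrow> nat" where
  "stretch x = (if x \<le> 3 * r then x else Suc x)"

lemma inj_stretch: "inj stretch"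
  by (auto simp: inj_def stretch_def split: if_splits)

lemma inj_image_stretch: "inj_on (image stretch) X"
  using inj_image_eq_iff[OF inj_stretch] by (auto simp: inj_on_def)

lemma stretch_rim:
  assumes "10 * r \<le> n"
  shows "stretch ` rim n = rim (Suc n)"
proof
  show "stretch ` rim n \<subseteq> rim (Suc n)"
    using assms by (auto simp: rim_def stretch_def)
  show "rim (Suc n) \<subseteq> stretch ` rim n"
  proof
    fix y assume y: "y \<in> rim (Suc n)"
    show "y \<in> stretch ` rim n"
      using y assms r_pos
      by (intro image_eqI[of _ _ "if y \<le> 3 * r then y else y - 1"]) (auto simp: rim_def stretch_def)
  qed
qed

text \<open>
  Long non-edges join the two ends.
\<close>

lemma IN_long_pair:
  assumes "r \<le> n" "S \<in> IN n" "x \<in> S" "y \<in> S" "x + r \<le> y"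
  shows "x < r" "n < y + r"
proof -
  have "\<not> pair_type G x (y - x) (n - y)" "1 \<le> x"
    using assms r_pos by (auto simp: IN_iff)
  then show "x < r" "n < y + r"
    using long_pair_left[of x "y - x" "n - y"] long_pair_right[of x "y - x" "n - y"] assms(5)
    by linarith+
qed

text \<open>
  A vertex within distance \<open>r\<close> of the marked one lies within \<open>3 * r\<close> of an end, and one farther away
  forms a long non-edge with it.
\<close>

lemma end_faces_rim:
  assumes "10 * r \<le> n" "S \<in> end_faces n"
  shows "S \<subseteq> rim n"
proof
  fix y assume y: "y \<in> S"
  have n: "r \<le> n" using assms by auto
  have S: "S \<in> IN n" using assms by (simp add: end_faces_def)
  obtain x where x: "x \<in> S" "x \<le> 2 * r \<or> n < x + 2 * r"
    using assms by (auto simp: end_faces_def)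
  have "y \<in> {1..n}" using S y n by (auto simp: IN_iff)
  moreover have "y \<le> 3 * r \<or> n < y + 3 * r"
    using IN_long_pair[OF n S x(1) y] IN_long_pair[OF n S y x(1)] x(2) assms(1)
    by linarith
  ultimately show "y \<in> rim n" by (simp add: rim_def)
qed

text \<open>
  The stretch changes only distances that are at least \<open>r\<close> both before and after, and these are
  invisible to adjacency.
\<close>

lemma pair_type_stretch:
  assumes "10 * r \<le> n" "x \<in> rim n" "y \<in> rim n" "x < y"
  shows "pair_type G (stretch x) (stretch y - stretch x) (Suc n - stretch y) \<longleftrightarrow>
    pair_type G x (y - x) (n - y)"
proof -
  have x: "1 \<le> x" "x \<le> 3 * r \<or> n < x + 3 * r" and y: "y \<le> n" "y \<le> 3 * r \<or> n < y + 3 * r"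
    using assms(2,3) by (auto simp: rim_def)
  have same: "pair_type G a b c \<longleftrightarrow> pair_type G a' b' c'"
    if "1 \<le> a" "1 \<le> a'" "r \<le> a + b + c" "r \<le> a' + b' + c'"
      "min a r = min a' r" "min b r = min b' r" "min c r = min c' r" for a b c a' b' c'
    using that by (intro iffI; elim pair_type_truncate) auto
  have "stretch x = x \<and> stretch y = y \<and> y \<le> 3 * r \<or>
      stretch x = x \<and> stretch y = Suc y \<and> x \<le> 3 * r \<and> n < y + 3 * r \<or>
      stretch x = Suc x \<and> stretch y = Suc y \<and> 3 * r < x"
    using assms(4) y by (auto simp: stretch_def)
  then show ?thesis
  proof (elim disjE conjE)
    assume "stretch x = x" "stretch y = y" "y \<le> 3 * r"
    then show ?thesis
      using x(1) assms(1,4) r_pos by (intro same) (simp_all add: min_absorb2)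
  next
    assume "stretch x = x" "stretch y = Suc y" "x \<le> 3 * r" "n < y + 3 * r"
    then show ?thesis
      using x(1) y(1) assms(1,4) r_pos by (intro same) (simp_all add: min_absorb2)
  next
    assume "stretch x = Suc x" "stretch y = Suc y" "3 * r < x"
    then show ?thesis
      using y(1) assms(1,4) r_pos by (intro same) (simp_all add: min_absorb2)
  qed
qed

lemma IN_stretch:
  assumes "10 * r \<le> n" "A \<subseteq> rim n"
  shows "stretch ` A \<in> IN (Suc n) \<longleftrightarrow> A \<in> IN n"
proof -
  have less: "stretch x < stretch y \<longleftrightarrow> x < y" for x y by (auto simp: stretch_def)
  have "stretch ` A \<subseteq> {1..Suc n}" "A \<subseteq> {1..n}"
    using assms(2) by (auto simp: rim_def stretch_def)
  then show ?thesis
    using assms pair_type_stretch[OF assms(1)]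
    by (subst (1 2) IN_iff) (auto simp: less subset_iff)
qed

lemma end_faces_Suc:
  assumes "10 * r \<le> n"
  shows "end_faces (Suc n) = image stretch ` end_faces n"
proof -
  have marked: "(stretch x \<le> 2 * r \<or> Suc n < stretch x + 2 * r) \<longleftrightarrow> (x \<le> 2 * r \<or> n < x + 2 * r)" for x
    using assms r_pos by (auto simp: stretch_def)
  have mem: "stretch ` A \<in> end_faces (Suc n) \<longleftrightarrow> A \<in> end_faces n" if "A \<subseteq> rim n" for A
    using IN_stretch[OF assms that] by (simp add: end_faces_def marked)
  show ?thesis
  proof
    show "image stretch ` end_faces n \<subseteq> end_faces (Suc n)"
      using mem end_faces_rim[OF assms] by auto
    show "end_faces (Suc n) \<subseteq> image stretch ` end_faces n"
    proof
      fix S assume S: "S \<in> end_faces (Suc n)"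
      then have "S \<subseteq> stretch ` rim n"
        using end_faces_rim[of "Suc n" S] assms stretch_rim by auto
      then obtain A where "A \<subseteq> rim n" "S = stretch ` A"
        by (auto elim: subset_imageE)
      then show "S \<in> image stretch ` end_faces n" using S mem by auto
    qed
  qed
qed

lemma facets_image:
  assumes "inj f"
  shows "facets (image f ` X) = image f ` facets X"
  by (simp only: facets_def Compr_image_eq ball_simps
      inj_image_subset_iff[OF assms] inj_image_eq_iff[OF assms])

text \<open>
  Meeting an end is inherited by supersets, so maximality can be tested inside \<open>end_faces\<close>.
\<close>

lemma facets_end: "facets (IN n) \<inter> end_faces n = facets (end_faces n)"
proof -
  have "F \<in> end_faces n" if "S \<in> end_faces n" "F \<in> IN n" "S \<subseteq> F" for S F
    using that unfolding end_faces_def by blast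
  moreover have "end_faces n \<subseteq> IN n" by (auto simp: end_faces_def)
  ultimately show ?thesis unfolding facets_def by blast
qed

section \<open>Faces in the middle\<close>

lemma mid_faces_iff:
  assumes "10 * r \<le> n"
  shows "S \<in> mid_faces n \<longleftrightarrow>
    (\<forall>x\<in>S. 2 * r < x \<and> x + 2 * r \<le> n) \<and> (\<forall>x\<in>S. \<forall>y\<in>S. y < x + width)"
proof -
  have "(\<forall>x\<in>S. \<forall>y\<in>S. x < y \<longrightarrow> \<not> pair_type G x (y - x) (n - y)) \<longleftrightarrow>
      (\<forall>x\<in>S. \<forall>y\<in>S. y < x + width)" if S: "\<forall>x\<in>S. 2 * r < x \<and> x + 2 * r \<le> n"
  proof -
    have "(x < y \<longrightarrow> \<not> pair_type G x (y - x) (n - y)) \<longleftrightarrow> y < x + width" if "x \<in> S" "y \<in> S" for x y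
    proof (cases "x < y")
      case True
      have "2 * r < x" "x + 2 * r \<le> n" "y + 2 * r \<le> n" using that S by auto
      then have "pair_type G x (y - x) (n - y) \<longleftrightarrow> width \<le> y - x"
        using True by (intro pair_type_middle) linarith+
      then show ?thesis using True by linarith
    qed (use width_bounds(1) in linarith)
    then show ?thesis by blast
  qed
  moreover have "S \<subseteq> {1..n}" if "\<forall>x\<in>S. 2 * r < x \<and> x + 2 * r \<le> n"
    using that by force
  ultimately show ?thesis
    using assms by (auto simp: mid_faces_def IN_iff)
qed

text \<open>
  The middle interval grows by the vertex \<open>Suc n - 2 * r\<close>; the new faces are those that contain it,
  together with any of the \<open>width - 1\<close> vertices before it.
\<close>

lemma mid_faces_Suc:
  assumes "10 * r \<le> n"
  shows "mid_faces (Suc n) =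
    mid_faces n \<union> insert (Suc n - 2 * r) ` Pow {Suc n - 2 * r - width<..n - 2 * r}"
    (is "_ = _ \<union> insert ?t ` Pow ?W")
proof (rule set_eqI, rule iffI)
  have n: "10 * r \<le> Suc n" using assms by simp
  fix S
  assume S: "S \<in> mid_faces (Suc n)"
  have mid: "2 * r < x" "x + 2 * r \<le> Suc n" if "x \<in> S" for x
    using S that unfolding mid_faces_iff[OF n] by blast+
  have diam: "y < x + width" if "x \<in> S" "y \<in> S" for x y
    using S that unfolding mid_faces_iff[OF n] by blast
  show "S \<in> mid_faces n \<union> insert ?t ` Pow ?W"
  proof (cases "?t \<in> S")
    case False
    have "x + 2 * r \<le> n" if "x \<in> S" for x
    proof -
      have "x \<noteq> ?t" using False that by blast
      then show ?thesis using mid(2)[OF that] by linarith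
    qed
    then have "S \<in> mid_faces n"
      using mid(1) diam unfolding mid_faces_iff[OF assms] by blast
    then show ?thesis ..
  next
    case True
    have "x \<in> ?W" if "x \<in> S - {?t}" for x
    proof -
      have "x \<in> S" "x \<noteq> ?t" using that by auto
      then show ?thesis using mid(2)[of x] diam[of x ?t] True width_bounds assms r_pos by auto
    qed
    then have "S - {?t} \<in> Pow ?W" by blast
    moreover have "S = insert ?t (S - {?t})" using True by auto
    ultimately show ?thesis by blast
  qed
next
  have n: "10 * r \<le> Suc n" using assms by simp
  fix S
  assume "S \<in> mid_faces n \<union> insert ?t ` Pow ?W"
  then show "S \<in> mid_faces (Suc n)"
  proof
    assume "S \<in> mid_faces n"
    then show ?thesis by (simp add: mid_faces_iff[OF n] mid_faces_iff[OF assms] le_SucI)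
  next
    assume "S \<in> insert ?t ` Pow ?W"
    then obtain A where "S = insert ?t A" "A \<subseteq> ?W" by auto
    then have "x = ?t \<or> x \<in> ?W" if "x \<in> S" for x using that by blast
    then have "?t < x + width \<and> x \<le> ?t" if "x \<in> S" for x
      using that width_bounds(1) by fastforce
    moreover have "2 * r < x \<and> x + 2 * r \<le> Suc n" if "?t < x + width \<and> x \<le> ?t" for x
      using that width_bounds(2) assms r_pos by linarith
    ultimately show ?thesis
      unfolding mid_faces_iff[OF n] by (meson le_less_trans)
  qed
qed

text \<open>
  The window need not be contained in the middle interval: this is what shows that a shorter piece
  cut off by the right margin is not a facet.
\<close>

lemma window_in_IN:
  assumes "2 * r < m" "m + 2 * r \<le> n"
  shows "{m..<m + width} \<in> IN n"
  using assms width_bounds r_pos pair_type_inner by (subst IN_iff) auto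

text \<open>
  A facet in the middle is contained in the window that starts at its minimum, and that window is a
  face, hence equal to it. Conversely a window is maximal, since a vertex outside it has distance at
  least \<open>width\<close> from the window's opposite endpoint, which is a middle vertex.
\<close>

lemma mid_facets:
  assumes "10 * r \<le> n"
  shows "facets (IN n) \<inter> mid_faces n = (\<lambda>m. {m..<m + width}) ` {2 * r<..n + 1 - 2 * r - width}"
proof (rule set_eqI, rule iffI)
  have n: "r \<le> n" using assms by simp
  fix S
  assume S: "S \<in> facets (IN n) \<inter> mid_faces n"
  have mid: "\<And>x. x \<in> S \<Longrightarrow> 2 * r < x \<and> x + 2 * r \<le> n"
    and diam: "\<And>x y. x \<in> S \<Longrightarrow> y \<in> S \<Longrightarrow> y < x + width"
    using S mid_faces_iff[OF assms] by blast+
  have max: "F = S" if "F \<in> IN n" "S \<subseteq> F" for F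
    using S that by (auto simp: facets_def)
  have fin: "finite S" using S IN_finite[OF n] by (auto simp: facets_def)
  have ne: "S \<noteq> {}"
    using max[OF window_in_IN[of "Suc (2 * r)" n]] assms width_bounds r_pos by auto
  define m where "m = Min S"
  have m: "m \<in> S" "\<And>x. x \<in> S \<Longrightarrow> m \<le> x" using fin ne by (auto simp: m_def)
  have "S \<subseteq> {m..<m + width}" using m diam by auto
  then have eq: "S = {m..<m + width}"
    using max window_in_IN[of m n] mid[OF m(1)] by auto
  then have "m + width - 1 \<in> S" using width_bounds by auto
  then have "m \<in> {2 * r<..n + 1 - 2 * r - width}"
    using mid[of "m + width - 1"] mid[OF m(1)] width_bounds(1) by auto
  then show "S \<in> (\<lambda>m. {m..<m + width}) ` {2 * r<..n + 1 - 2 * r - width}"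
    using eq by blast
next
  have n: "r \<le> n" using assms by simp
  fix S
  assume "S \<in> (\<lambda>m. {m..<m + width}) ` {2 * r<..n + 1 - 2 * r - width}"
  then obtain m where S: "S = {m..<m + width}" and m: "2 * r < m" "m + width \<le> n + 1 - 2 * r"
    using assms width_bounds by auto
  have "F \<subseteq> S" if F: "F \<in> IN n" "S \<subseteq> F" for F
  proof
    fix v assume v: "v \<in> F"
    have mem: "m \<in> F" "m + width - 1 \<in> F" using F(2) S width_bounds by auto
    have "1 \<le> v" "v \<le> n" using v F(1) n by (auto simp: IN_iff)
    have nonadj: "\<not> pair_type G x (y - x) (n - y)" if "x \<in> F" "y \<in> F" "x < y" for x y
      using F(1) n that by (auto simp: IN_iff)
    have "\<not> v < m"
    proof
      assume "v < m"
      then have "pair_type G v (m + width - 1 - v) (n - (m + width - 1))"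
        using \<open>1 \<le> v\<close> m width_bounds(1) by (subst pair_type_middle) auto
      moreover have "v < m + width - 1" using \<open>v < m\<close> width_bounds(1) by linarith
      ultimately show False using nonadj[OF v mem(2)] by blast
    qed
    moreover have "\<not> m + width \<le> v"
    proof
      assume "m + width \<le> v"
      then have "pair_type G m (v - m) (n - v)"
        using \<open>v \<le> n\<close> m width_bounds(1) by (subst pair_type_middle) auto
      moreover have "m < v" using \<open>m + width \<le> v\<close> width_bounds(1) by linarith
      ultimately show False using nonadj[OF mem(1) v] by blast
    qed
    ultimately show "v \<in> S" using S by auto
  qed
  moreover have "S \<in> IN n" using window_in_IN[of m n] S m width_bounds by auto
  moreover from this have "S \<in> mid_faces n"
    using S m width_bounds assms by (auto simp: mid_faces_def)
  ultimately show "S \<in> facets (IN n) \<inter> mid_faces n" by (auto simp: facets_def)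
qed

section \<open>One step of the chain\<close>

text \<open>
  Faces near the ends keep their cardinalities under the stretch, and the faces in the middle realize
  all cardinalities up to \<open>width\<close> for every \<open>n\<close>.
\<close>

lemma card_image_IN_Suc:
  assumes "10 * r \<le> n"
  shows "card ` IN (Suc n) = card ` IN n"
proof -
  have "card ` end_faces (Suc n) = card ` end_faces n"
    using inj_stretch
    by (simp add: end_faces_Suc[OF assms] image_image card_image inj_on_subset[OF inj_stretch])
  moreover have mid: "card ` mid_faces k = {..width}" if k: "10 * r \<le> k" for k
  proof
    show "card ` mid_faces k \<subseteq> {..width}"
    proof clarsimp
      fix S assume S: "S \<in> mid_faces k"
      show "card S \<le> width"
      proof (cases "S = {}")
        case False
        have "finite S" using S IN_finite[of k S] k by (auto simp: mid_faces_def)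
        then have "Min S \<in> S" "\<And>x. x \<in> S \<Longrightarrow> Min S \<le> x" using False by auto
        then have "S \<subseteq> {Min S..<Min S + width}"
          using S unfolding mid_faces_iff[OF k] by auto
        then show ?thesis using card_mono[of "{Min S..<Min S + width}" S] by auto
      qed simp
    qed
    show "{..width} \<subseteq> card ` mid_faces k"
    proof
      fix l assume "l \<in> {..width}"
      then have "{Suc (2 * r)..<Suc (2 * r) + l} \<in> mid_faces k"
        unfolding mid_faces_iff[OF k] using k width_bounds by auto
      then show "l \<in> card ` mid_faces k" by (intro image_eqI) auto
    qed
  qed
  ultimately show ?thesis
    using mid[OF assms] mid[of "Suc n"] assms by (simp add: IN_split(1) image_Un)
qed

lemma f_num_Suc:
  assumes "10 * r \<le> n"
  shows "f_num (IN (Suc n)) (int k) = f_num (IN n) (int k) + (width - 1 choose k)"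
proof -
  let ?t = "Suc n - 2 * r" and ?W = "{Suc n - 2 * r - width<..n - 2 * r}"
  let ?B = "insert ?t ` {A. A \<subseteq> ?W \<and> card A = k}"
  have f: "f_num (IN m) (int k) =
      card {S \<in> end_faces m. card S = Suc k} + card {S \<in> mid_faces m. card S = Suc k}"
    if "r \<le> m" for m
  proof -
    have "f_num (IN m) (int k) = card ({S \<in> end_faces m. card S = Suc k} \<union> {S \<in> mid_faces m. card S = Suc k})"
      unfolding f_num_def IN_split(1) by (rule arg_cong[where f = card]) auto
    also have "\<dots> = card {S \<in> end_faces m. card S = Suc k} + card {S \<in> mid_faces m. card S = Suc k}"
      using finite_IN[OF that] IN_split[of m] by (intro card_Un_disjoint) auto
    finally show ?thesis .
  qed
  have "{S \<in> end_faces (Suc n). card S = Suc k} = image stretch ` {S \<in> end_faces n. card S = Suc k}"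
    by (auto simp: end_faces_Suc[OF assms] card_image inj_on_subset[OF inj_stretch])
  then have ends: "card {S \<in> end_faces (Suc n). card S = Suc k} = card {S \<in> end_faces n. card S = Suc k}"
    by (simp add: card_image inj_image_stretch)
  have tW: "?t \<notin> ?W" using assms r_pos by auto
  have cardS: "card (insert ?t A) = Suc (card A)" if "A \<subseteq> ?W" for A
    using that tW finite_subset[of A ?W] by (subst card_insert_disjoint) auto
  have "{S \<in> mid_faces (Suc n). card S = Suc k} = {S \<in> mid_faces n. card S = Suc k} \<union>
      insert ?t ` {A \<in> Pow ?W. card (insert ?t A) = Suc k}"
    unfolding mid_faces_Suc[OF assms] by blast
  also have "{A \<in> Pow ?W. card (insert ?t A) = Suc k} = {A. A \<subseteq> ?W \<and> card A = k}"
    using cardS by (metis (no_types, lifting) PowD PowI Suc_inject)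
  finally have "{S \<in> mid_faces (Suc n). card S = Suc k} = {S \<in> mid_faces n. card S = Suc k} \<union> ?B" .
  moreover have "{S \<in> mid_faces n. card S = Suc k} \<inter> ?B = {}"
    using assms r_pos by (auto simp: mid_faces_def)
  moreover have "finite {S \<in> mid_faces n. card S = Suc k}"
    using finite_IN[of n] assms IN_split(1)[of n] by auto
  moreover have "finite ?B" by simp
  ultimately have mids: "card {S \<in> mid_faces (Suc n). card S = Suc k} =
      card {S \<in> mid_faces n. card S = Suc k} + card ?B"
    by (simp add: card_Un_disjoint)
  have "inj_on (insert ?t) {A. A \<subseteq> ?W \<and> card A = k}"
  proof (rule inj_onI)
    fix A B assume AB: "A \<in> {A. A \<subseteq> ?W \<and> card A = k}" "B \<in> {A. A \<subseteq> ?W \<and> card A = k}"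
      "insert ?t A = insert ?t B"
    then have "?t \<notin> A" "?t \<notin> B" using tW by blast+
    from insert_ident[OF this] show "A = B" using AB(3) by (rule iffD1)
  qed
  then have "card ?B = card {A. A \<subseteq> ?W \<and> card A = k}" by (rule card_image)
  also have "\<dots> = (card ?W choose k)" by (intro n_subsets) simp
  also have "card ?W = width - 1" using assms width_bounds by auto
  finally have B: "card ?B = (width - 1 choose k)" .
  have "r \<le> n" "r \<le> Suc n" using assms by auto
  then show ?thesis unfolding f[OF \<open>r \<le> n\<close>] f[OF \<open>r \<le> Suc n\<close>] ends mids B by (simp only: add.assoc)
qed

lemma card_facets_Suc:
  assumes "10 * r \<le> n"
  shows "card (facets (IN (Suc n))) = Suc (card (facets (IN n)))"
proof -
  have split: "card (facets (IN m)) = card (facets (end_faces m)) + (m + 1 - 4 * r - width)"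
    if m: "10 * r \<le> m" for m
  proof -
    have "facets (IN m) = facets (end_faces m) \<union> (facets (IN m) \<inter> mid_faces m)"
      unfolding facets_end[symmetric] using IN_split(1)[of m] by (auto simp: facets_def)
    moreover have "facets (end_faces m) \<inter> (facets (IN m) \<inter> mid_faces m) = {}"
      unfolding facets_end[symmetric] using IN_split(2)[of m] by auto
    moreover have "finite (facets (IN m))" using finite_IN[of m] m by (auto simp: facets_def)
    ultimately have "card (facets (IN m)) =
        card (facets (end_faces m)) + card (facets (IN m) \<inter> mid_faces m)"
      by (metis card_Un_disjoint finite_Un)
    moreover have "inj (\<lambda>m. {m..<m + width})"
      using width_bounds by (intro injI) (auto simp: atLeastLessThan_eq_iff)
    from inj_on_subset[OF this subset_UNIV]
    have "card (facets (IN m) \<inter> mid_faces m) = card {2 * r<..m + 1 - 2 * r - width}"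
      unfolding mid_facets[OF m] by (rule card_image)
    ultimately show ?thesis by (simp add: diff_diff_eq)
  qed
  have ends: "card (facets (end_faces (Suc n))) = card (facets (end_faces n))"
    unfolding end_faces_Suc[OF assms] facets_image[OF inj_stretch]
    by (simp add: card_image inj_image_stretch)
  have "10 * r \<le> Suc n" using assms by simp
  note split = split[OF assms] split[OF this]
  have "Suc n + 1 - 4 * r - width = Suc (n + 1 - 4 * r - width)"
    using assms width_bounds(2) by linarith
  then show ?thesis unfolding split ends by (simp only: add_Suc_right)
qed

section \<open>Eventual behaviour of the invariants\<close>

lemma independence_number_eq: "independence_number (G n) = Max (card ` IN n)"
  unfolding independence_number_def independence_complex_def by (simp only: image_Collect)

lemma card_image_IN_eq:
  assumes "10 * r \<le> n"
  shows "card ` IN n = card ` IN (10 * r)"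
  using assms by (induction rule: dec_induct) (simp_all only: card_image_IN_Suc)

lemma f_num_eventually_linear: "eventually_linear (\<lambda>n. int (f_num (IN n) (int k)))"
  by (rule eventually_linear_if_constant_increment[of "10 * r" _ "int (width - 1 choose k)"])
     (simp add: f_num_Suc)

lemma f_num_minus_one:
  assumes "r \<le> n"
  shows "f_num (IN n) (- 1) = 1"
proof -
  have "{F \<in> IN n. int (card F) = - 1 + 1} = {{}}"
    using IN_finite[OF assms] IN_iff[OF assms, of "{}"] by auto
  then show ?thesis by (simp add: f_num_def)
qed

text \<open>
  Once the dimension is constant, the binomial coefficients in the definition no longer depend on
  \<open>n\<close>.
\<close>

lemma h_num_eventually_linear: "eventually_linear (\<lambda>n. h_num (IN n) k)"
proof -
  define d where "d = Max (card ` IN (10 * r))"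
  have d: "nat (complex_dim (IN n) + 1) = d" if "10 * r \<le> n" for n
    using card_image_IN_eq[OF that] by (simp add: complex_dim_def d_def)
  have "eventually_linear (\<lambda>n. int (f_num (IN n) (int l - 1)))" for l
  proof (cases l)
    case 0
    have "1 = int (f_num (IN n) (int l - 1))" if "r \<le> n" for n
      using f_num_minus_one[OF that] 0 by simp
    then show ?thesis
      by (rule eventually_linear_cong[OF eventually_linear_const])
  next
    case (Suc m)
    then show ?thesis using f_num_eventually_linear[of m] by simp
  qed
  then have "eventually_linear (\<lambda>n. if k \<le> d then \<Sum>l=0..k. (-1) ^ (k - l) *
      int ((d - l) choose (k - l)) * int (f_num (IN n) (int l - 1)) else 0)"
    by (cases "k \<le> d") (simp_all add: eventually_linear_sum eventually_linear_cmult eventually_linear_const)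
  then show ?thesis
    by (rule eventually_linear_cong[of _ "10 * r"]) (simp only: h_num_def d Let_def)
qed

lemma independence_number_eventually_const:
  "\<exists>c. eventually (\<lambda>n. independence_number (G n) = c) sequentially"
  unfolding independence_number_eq eventually_sequentially using card_image_IN_eq by metis

lemma card_facets_eventually:
  "\<exists>C::int. eventually (\<lambda>n. int (card (facets (IN n))) = int n + C) sequentially"
  unfolding eventually_sequentially
  using constant_increment[of "10 * r" "\<lambda>n. int (card (facets (IN n)))" 1] card_facets_Suc
  by (metis (no_types, lifting) mult_1 of_nat_Suc add.commute)

end

theorem theorem1p2:
  fixes G :: "nat \<Rightarrow> ngraph" and r i j :: nat
  assumes "Inc_invariant_chain G"
    and "r = stability_index G"
    and "verts (G r) = {1..r}"
    and "i \<in> {1..r}" and "j \<in> {1..r}"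
    and "{1, i} \<in> edges (G r)" and "{j, r} \<in> edges (G r)"
  shows "(\<exists>c. eventually (\<lambda>n. independence_number (G n) = c) sequentially) \<and>
    (\<forall>k::nat. eventually_linear (\<lambda>n. int (f_num (independence_complex (G n)) (int k)))) \<and>
    (\<forall>k::nat. eventually_linear (\<lambda>n. h_num (independence_complex (G n)) k)) \<and>
    (\<exists>C::int. eventually (\<lambda>n. int (card (facets (independence_complex (G n)))) = int n + C)
      sequentially)"
proof -
  have "r \<ge> 1 \<and> (\<forall>n\<ge>r. \<forall>m\<ge>n. act (Inc_bounded n m) (G n) = G m)"
    unfolding assms(2) stability_index_def
    by (rule LeastI_ex) (use chain_stabilizes[OF assms(1)] in blast)
  then interpret linked_chain G r i j
    using assms by unfold_locales auto
  show ?thesis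
    using independence_number_eventually_const f_num_eventually_linear h_num_eventually_linear
      card_facets_eventually by blast
qed

end
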